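(* Let $(I^*,S^* )\in\mathcal F^*$ be a solution of the DEDS problem (defined in the context). Then the DEDS problem and the modified DEDS problem $$\text{minimize } f^\epsilon(I,S)\ \text{ over }(I,S)\in\mathbb R^{2n\mathfrak h}\quad\text{subject to}\quad\mathbf 1_n^\top I^{(k)}=l^{(k)}\ \text{ for all }k\in\{1,\dots,\mathfrak h\}$$ have the same optimizers for every $\epsilon>0$ satisfying $$\epsilon<\frac{\rho}{f(I^\rho+S^\rho)-f(I^*+S^* )}.$$
   Context: **Notation.** $\mathbf 1_n$ and $\mathbf 0_n$ are the all-ones and all-zeros vectors in $\mathbb R^n$; vector inequalities are componentwise; $[u]^+=\max\{0,u\}$, applied componentwise to vectors. A vector $y\in\mathbb R^{n\mathfrak h}$ is written $y=(y^{(1)};\dots;y^{(\mathfrak h)})$ with blocks $y^{(k)}\in\mathbb R^n$. **DEDS problem.** Let $n,\mathfrak h\ge1$ be integers and $\mathcal K=\{1,\dots,\mathfrak h\}$. The total load is $l\in\mathbb R_{>0}^{\mathfrak h}$. The vectors $P^m,P^M,C^m,C^M,R^l,R^u,S^{(0)}\in\mathbb R^n$ satisfy, for each $i$: $[P_i^m,P_i^M]\subset\mathbb R_{>0}$, $C^m_i\ge0$, $C^M_i>0$, $R^l_i,R^u_i>0$, $S^{(0)}_i\in[C_i^m,C_i^M]$. The costs $f_i^{(k)}:\mathbb R\to\mathbb R_{\ge0}$ are convex and continuously differentiable, and $f(x)=\sum_{k=1}^{\mathfrak h}\sum_{i=1}^nf_i^{(k)}(x_i^{(k)})$ for $x\in\mathbb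 R^{n\mathfrak h}$. The DEDS problem is to minimize $f(I+S)$ over $(I,S)\in\mathbb R^{2n\mathfrak h}$ (with $I,S\in\mathbb R^{n\mathfrak h}$) subject to, for $k\in\mathcal K$: $\mathbf 1_n^\top I^{(k)}=l^{(k)}$; $P^m\le I^{(k)}+S^{(k)}\le P^M$; $C^m\le S^{(0)}+\sum_{k'=1}^kS^{(k')}\le C^M$; $\mathbf 0_n\le I^{(k)}$; and, for $k\in\mathcal K\setminus\{\mathfrak h\}$: $-R^l\le I^{(k+1)}+S^{(k+1)}-I^{(k)}-S^{(k)}\le R^u$. The feasible set and the solution set $\mathcal F^*$ of the DEDS problem are assumed nonempty. **Strong Slater condition (standing assumption).** There are $\rho>0$ and a point $(I^\rho,S^\rho)\in\mathbb R^{2n\mathfrak h}$ satisfying all the equality constraints of the DEDS problem and such that every scalar inequality constraint, written as $g_j(I,S)\le0$, satisfies $g_j(I^\rho,S^\rho)<-\rho$. **Penalized cost.** For $\epsilon>0$, $$f^\epsilon(I,S)=f(I+S)+\frac1\epsilon\Big(\sum_{k=1}^{\mathfrak h}\mathbf 1_n^\top\sum_{j=1}^5[T_j^{(k)}]^++\sum_{k=1}^{\mathfrak h-1}\mathbf 1_n^\top([T_6^{(k)}]^++[T_7^{(k)}]^+)\Big),$$ where $T_1^{(k)}=P^m-I^{(k)}-S^{(k)}$, $T_2^{(k)}=I^{(k)}+S^{(k)}-P^M$, $T_3^{(k)}=C^m-S^{(0)}-\sum_{k'=1}^kS^{(k')}$, $T_4^{(k)}=S^{(0)}+\sum_{k'=1}^kS^{(k')}-C^M$,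 $T_5^{(k)}=-I^{(k)}$, $T_6^{(k)}=-R^l-I^{(k+1)}-S^{(k+1)}+I^{(k)}+S^{(k)}$, $T_7^{(k)}=I^{(k+1)}+S^{(k+1)}-I^{(k)}-S^{(k)}-R^u$. *)

theory Defs
  imports "HOL-Analysis.Analysis"
begin

(* The n generators are the elements of the finite type 'n, the time slots are {1..horizon D}. *)
record ('n::finite) deds =
  horizon :: nat
  load :: "nat \<Rightarrow> real"
  Pmin :: "real^'n"
  Pmax :: "real^'n"
  Cmin :: "real^'n"
  Cmax :: "real^'n"
  Rlow :: "real^'n"
  Rupp :: "real^'n"
  S0 :: "real^'n"
  cost :: "nat \<Rightarrow> 'n \<Rightarrow> real \<Rightarrow> real"

definition deds_data :: "('n::finite) deds \<Rightarrow> bool" where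
  "deds_data D \<longleftrightarrow>
     1 \<le> horizon D \<and>
     (\<forall>k\<in>{1..horizon D}. 0 < load D k) \<and>
     (\<forall>i. {Pmin D $ i .. Pmax D $ i} \<subseteq> {0<..} \<and>
          0 \<le> Cmin D $ i \<and> 0 < Cmax D $ i \<and>
          0 < Rlow D $ i \<and> 0 < Rupp D $ i \<and>
          S0 D $ i \<in> {Cmin D $ i .. Cmax D $ i}) \<and>
     (\<forall>k\<in>{1..horizon D}. \<forall>i.
          (\<forall>x. 0 \<le> cost D k i x) \<and>
          convex_on UNIV (cost D k i) \<and>
          cost D k i C1_differentiable_on UNIV)"

(* A vector in R^(n h) is the family of its h blocks. Families are undefined outside
   {1..horizon D}, so that equality of families is equality of vectors. *)
type_synonym 'n blocks = "nat \<Rightarrow> real^'n"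

definition deds_space :: "('n::finite) deds \<Rightarrow> ('n blocks \<times> 'n blocks) set" where
  "deds_space D = ({1..horizon D} \<rightarrow>\<^sub>E UNIV) \<times> ({1..horizon D} \<rightarrow>\<^sub>E UNIV)"

definition total_cost :: "('n::finite) deds \<Rightarrow> 'n blocks \<Rightarrow> real" where
  "total_cost D x = (\<Sum>k\<in>{1..horizon D}. \<Sum>i\<in>UNIV. cost D k i (x k $ i))"

definition deds_objective :: "('n::finite) deds \<Rightarrow> 'n blocks \<times> 'n blocks \<Rightarrow> real" where
  "deds_objective D = (\<lambda>(I, S). total_cost D (\<lambda>k. I k + S k))"

definition load_set :: "('n::finite) deds \<Rightarrow> ('n blocks \<times> 'n blocks) set" where
  "load_set D = {(I, S) \<in> deds_space D. \<forall>k\<in>{1..horizon D}. 1 \<bullet> I k = load D k}"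

definition deds_feasible :: "('n::finite) deds \<Rightarrow> ('n blocks \<times> 'n blocks) set" where
  "deds_feasible D = {(I, S) \<in> load_set D.
     (\<forall>k\<in>{1..horizon D}.
        Pmin D \<le> I k + S k \<and> I k + S k \<le> Pmax D \<and>
        Cmin D \<le> S0 D + (\<Sum>k'=1..k. S k') \<and> S0 D + (\<Sum>k'=1..k. S k') \<le> Cmax D \<and>
        0 \<le> I k) \<and>
     (\<forall>k\<in>{1..<horizon D}.
        - Rlow D \<le> I (k + 1) + S (k + 1) - I k - S k \<and>
        I (k + 1) + S (k + 1) - I k - S k \<le> Rupp D)}"

(* T_1, ..., T_5: the left-hand sides g of the inequality constraints g <= 0 for slot k. *)
definition slot_terms :: "('n::finite) deds \<Rightarrow> 'n blocks \<times> 'n blocks \<Rightarrow> nat \<Rightarrow> (real^'n) list" where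
  "slot_terms D = (\<lambda>(I, S) k.
     [Pmin D - I k - S k,
      I k + S k - Pmax D,
      Cmin D - S0 D - (\<Sum>k'=1..k. S k'),
      S0 D + (\<Sum>k'=1..k. S k') - Cmax D,
      - I k])"

(* T_6, T_7: the same for the ramp constraints between slots k and k + 1. *)
definition ramp_terms :: "('n::finite) deds \<Rightarrow> 'n blocks \<times> 'n blocks \<Rightarrow> nat \<Rightarrow> (real^'n) list" where
  "ramp_terms D = (\<lambda>(I, S) k.
     [- Rlow D - I (k + 1) - S (k + 1) + I k + S k,
      I (k + 1) + S (k + 1) - I k - S k - Rupp D])"

(* The order < on real^'n is not the componentwise strict order, hence the components. *)
definition strong_slater :: "('n::finite) deds \<Rightarrow> real \<Rightarrow> 'n blocks \<times> 'n blocks \<Rightarrow> bool" where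
  "strong_slater D \<rho> p \<longleftrightarrow>
     0 < \<rho> \<and> p \<in> load_set D \<and>
     (\<forall>k\<in>{1..horizon D}. \<forall>T\<in>set (slot_terms D p k). \<forall>i. T $ i < - \<rho>) \<and>
     (\<forall>k\<in>{1..<horizon D}. \<forall>T\<in>set (ramp_terms D p k). \<forall>i. T $ i < - \<rho>)"

definition pos_part :: "real^'n \<Rightarrow> real^('n::finite)" where
  "pos_part u = (\<chi> i. max 0 (u $ i))"

definition penalized_objective ::
    "('n::finite) deds \<Rightarrow> real \<Rightarrow> 'n blocks \<times> 'n blocks \<Rightarrow> real" where
  "penalized_objective D \<epsilon> p = deds_objective D p + 1 / \<epsilon> *
     ((\<Sum>k\<in>{1..horizon D}. 1 \<bullet> (\<Sum>T\<leftarrow>slot_terms D p k. pos_part T)) +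
      (\<Sum>k\<in>{1..<horizon D}. 1 \<bullet> (\<Sum>T\<leftarrow>ramp_terms D p k. pos_part T)))"

definition deds_solutions :: "('n::finite) deds \<Rightarrow> ('n blocks \<times> 'n blocks) set" where
  "deds_solutions D = {p. is_arg_min (deds_objective D) (\<lambda>q. q \<in> deds_feasible D) p}"

definition modified_deds_solutions ::
    "('n::finite) deds \<Rightarrow> real \<Rightarrow> ('n blocks \<times> 'n blocks) set" where
  "modified_deds_solutions D \<epsilon> =
     {p. is_arg_min (penalized_objective D \<epsilon>) (\<lambda>q. q \<in> load_set D) p}"

end

theory Submission
  imports Defs
begin

text \<open>
  The penalty is exact because the total constraint violation \<open>v(p)\<close> of a load-balanced point \<open>p\<close>
  controls how far the cost can drop below the optimal value \<open>f*\<close>. Every scalar constraint function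
  is affine, is at most \<open>v(p)\<close> at \<open>p\<close>, and is below \<open>-\<rho>\<close> at the Slater point \<open>s\<close>. Hence the convex
  combination of \<open>p\<close> and \<open>s\<close> with weight \<open>t = v(p) / (v(p) + \<rho>)\<close> on \<open>s\<close> is feasible
  (\<open>feasible_towards_slater\<close>), and convexity of the cost gives
  \<open>f* \<le> (1 - t) f(p) + t f(s)\<close>, that is, \<open>f(p) \<ge> f* - v(p) (f(s) - f*) / \<rho>\<close>.
  If \<open>1/\<epsilon>\<close> exceeds the slope \<open>(f(s) - f*) / \<rho>\<close>, the penalty \<open>v(p) / \<epsilon>\<close> more than compensates
  this drop wherever \<open>v(p) > 0\<close>. The penalized cost therefore exceeds \<open>f*\<close> at all infeasible
  points and agrees with \<open>f\<close> at the feasible ones, which forces the minimizers to coincide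
  (\<open>exact_penalty\<close>).
\<close>

section \<open>Exact penalties over an abstract constraint set\<close>

text \<open>
  The fourth assumption is the inequality \<open>f q \<le> (1 - t) f p + t fs\<close> with \<open>t = v p / (v p + \<rho>)\<close>,
  cleared of its denominator: convexity of \<open>f\<close> and the Slater point enter only through it.
\<close>

lemma exact_penalty:
  fixes f v :: "'a \<Rightarrow> real" and \<rho> \<epsilon> fs :: real
  assumes sub: "F \<subseteq> X"
    and v_nonneg: "\<And>p. p \<in> X \<Longrightarrow> 0 \<le> v p"
    and v_zero: "\<And>p. p \<in> X \<Longrightarrow> v p = 0 \<longleftrightarrow> p \<in> F"
    and towards: "\<And>p. p \<in> X \<Longrightarrow> \<exists>q\<in>F. (v p + \<rho>) * f q \<le> \<rho> * f p + v p * fs"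
    and opt: "is_arg_min f (\<lambda>q. q \<in> F) z"
    and "0 < \<rho>" "0 < \<epsilon>" and slope: "\<epsilon> * (fs - f z) < \<rho>"
  shows "is_arg_min f (\<lambda>q. q \<in> F) p \<longleftrightarrow>
    is_arg_min (\<lambda>q. f q + 1 / \<epsilon> * v q) (\<lambda>q. q \<in> X) p"
proof -
  let ?g = "\<lambda>q. f q + 1 / \<epsilon> * v q"
  have z: "z \<in> F" and min_z: "\<And>q. q \<in> F \<Longrightarrow> f z \<le> f q"
    using opt by (auto simp: is_arg_min_linorder)
  have on_F: "?g q = f q" if "q \<in> F" for q
    using v_zero that sub by auto
  have above: "f z < ?g q" if q: "q \<in> X" "q \<notin> F" for q
  proof -
    have v: "0 < v q"
      using v_nonneg[of q] v_zero[of q] q by linarith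
    obtain r where "r \<in> F" and r: "(v q + \<rho>) * f r \<le> \<rho> * f q + v q * fs"
      using towards[OF q(1)] by blast
    have "(v q + \<rho>) * f z \<le> (v q + \<rho>) * f r"
      using min_z[OF \<open>r \<in> F\<close>] v \<open>0 < \<rho>\<close> by (intro mult_left_mono) auto
    with r have "\<rho> * (f z - f q) \<le> v q * (fs - f z)"
      by (simp add: algebra_simps)
    then have "\<epsilon> * (\<rho> * (f z - f q)) \<le> \<epsilon> * (v q * (fs - f z))"
      using \<open>0 < \<epsilon>\<close> by (intro mult_left_mono) auto
    also have "\<dots> = v q * (\<epsilon> * (fs - f z))"
      by simp
    also have "\<dots> < v q * \<rho>"
      using slope v by simp
    finally have "\<rho> * (\<epsilon> * (f z - f q)) < \<rho> * v q"
      by (simp add: mult_ac)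
    then have "\<epsilon> * (f z - f q) < v q"
      using \<open>0 < \<rho>\<close> by simp
    then show ?thesis
      using \<open>0 < \<epsilon>\<close> by (simp add: field_simps)
  qed
  have lower: "f z \<le> ?g q" if "q \<in> X" for q
    using above[OF that] min_z[of q] on_F[of q] by fastforce
  show ?thesis
  proof
    assume "is_arg_min f (\<lambda>q. q \<in> F) p"
    then have "p \<in> F" "f p \<le> f z"
      using z by (auto simp: is_arg_min_linorder)
    moreover have "?g p \<le> ?g q" if "q \<in> X" for q
      using lower[OF that] on_F[OF \<open>p \<in> F\<close>] \<open>f p \<le> f z\<close> by linarith
    ultimately show "is_arg_min ?g (\<lambda>q. q \<in> X) p"
      using sub by (auto simp: is_arg_min_linorder)
  next
    assume "is_arg_min ?g (\<lambda>q. q \<in> X) p"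
    then have p: "p \<in> X" and min_p: "\<And>q. q \<in> X \<Longrightarrow> ?g p \<le> ?g q"
      by (auto simp: is_arg_min_linorder)
    have "?g p \<le> f z"
      using min_p[of z] on_F[OF z] z sub by auto
    then have "p \<in> F"
      using above[OF p] by force
    then show "is_arg_min f (\<lambda>q. q \<in> F) p"
      using \<open>?g p \<le> f z\<close> on_F min_z by (force simp: is_arg_min_linorder)
  qed
qed

section \<open>The constraint violation\<close>

definition list_violation :: "(real^'n::finite) list \<Rightarrow> real" where
  "list_violation Ts = 1 \<bullet> (\<Sum>T\<leftarrow>Ts. pos_part T)"

definition violation :: "('n::finite) deds \<Rightarrow> 'n blocks \<times> 'n blocks \<Rightarrow> real" where
  "violation D p = (\<Sum>k\<in>{1..horizon D}. list_violation (slot_terms D p k)) +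
     (\<Sum>k\<in>{1..<horizon D}. list_violation (ramp_terms D p k))"

lemma one_inner_pos_part: "1 \<bullet> pos_part T = (\<Sum>i\<in>UNIV. max 0 (T $ i))"
  by (simp add: inner_vec_def pos_part_def)

lemma list_violation_Nil [simp]: "list_violation [] = 0"
  by (simp add: list_violation_def)

lemma list_violation_Cons [simp]:
  "list_violation (T # Ts) = (\<Sum>i\<in>UNIV. max 0 (T $ i)) + list_violation Ts"
  by (simp add: list_violation_def inner_add_right one_inner_pos_part)

lemma list_violation_nonneg: "0 \<le> list_violation Ts"
  by (induction Ts) (auto intro!: add_nonneg_nonneg sum_nonneg)

lemma le_list_violation: "T \<in> set Ts \<Longrightarrow> T $ i \<le> list_violation Ts"
proof (induction Ts)
  case (Cons U Us)
  have "U $ i \<le> max 0 (U $ i)"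
    by simp
  also have "\<dots> \<le> (\<Sum>i\<in>UNIV. max 0 (U $ i))"
    by (rule member_le_sum) auto
  finally have "U $ i \<le> (\<Sum>i\<in>UNIV. max 0 (U $ i))" .
  moreover have "0 \<le> (\<Sum>i\<in>UNIV. max 0 (U $ i))"
    by (auto intro!: sum_nonneg)
  ultimately show ?case
    using Cons list_violation_nonneg[of Us] by fastforce
qed simp

lemma list_violation_eq_0:
  "(\<And>T i. T \<in> set Ts \<Longrightarrow> T $ i \<le> 0) \<Longrightarrow> list_violation Ts = 0"
  by (induction Ts) (auto intro!: sum.neutral simp: max_def antisym)

lemma penalized_objective_violation:
  "penalized_objective D \<epsilon> p = deds_objective D p + 1 / \<epsilon> * violation D p"
  by (simp add: penalized_objective_def violation_def list_violation_def)

lemma violation_nonneg: "0 \<le> violation D p"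
  by (auto simp: violation_def intro!: add_nonneg_nonneg sum_nonneg list_violation_nonneg)

lemma slot_le_violation:
  assumes "k \<in> {1..horizon D}" "T \<in> set (slot_terms D p k)"
  shows "T $ i \<le> violation D p"
proof -
  have "T $ i \<le> list_violation (slot_terms D p k)"
    using assms by (simp add: le_list_violation)
  also have "\<dots> \<le> (\<Sum>k\<in>{1..horizon D}. list_violation (slot_terms D p k))"
    using assms by (intro member_le_sum) (auto simp: list_violation_nonneg)
  also have "\<dots> \<le> violation D p"
    by (simp add: violation_def sum_nonneg list_violation_nonneg)
  finally show ?thesis .
qed

lemma ramp_le_violation:
  assumes "k \<in> {1..<horizon D}" "T \<in> set (ramp_terms D p k)"
  shows "T $ i \<le> violation D p"
proof -
  have "T $ i \<le> list_violation (ramp_terms D p k)"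
    using assms by (simp add: le_list_violation)
  also have "\<dots> \<le> (\<Sum>k\<in>{1..<horizon D}. list_violation (ramp_terms D p k))"
    using assms by (intro member_le_sum) (auto simp: list_violation_nonneg)
  also have "\<dots> \<le> violation D p"
    by (simp add: violation_def sum_nonneg list_violation_nonneg)
  finally show ?thesis .
qed

lemma deds_feasible_iff:
  "p \<in> deds_feasible D \<longleftrightarrow> p \<in> load_set D \<and>
     (\<forall>k\<in>{1..horizon D}. \<forall>T\<in>set (slot_terms D p k). \<forall>i. T $ i \<le> 0) \<and>
     (\<forall>k\<in>{1..<horizon D}. \<forall>T\<in>set (ramp_terms D p k). \<forall>i. T $ i \<le> 0)"
proof (cases p)
  case (Pair I S)
  have slot: "(\<forall>T\<in>set (slot_terms D p k). \<forall>i. T $ i \<le> 0) \<longleftrightarrow>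
      Pmin D \<le> I k + S k \<and> I k + S k \<le> Pmax D \<and>
      Cmin D \<le> S0 D + (\<Sum>k'=1..k. S k') \<and> S0 D + (\<Sum>k'=1..k. S k') \<le> Cmax D \<and>
      0 \<le> I k" for k
    by (simp add: Pair slot_terms_def less_eq_vec_def algebra_simps)
  have ramp: "(\<forall>T\<in>set (ramp_terms D p k). \<forall>i. T $ i \<le> 0) \<longleftrightarrow>
      - Rlow D \<le> I (k + 1) + S (k + 1) - I k - S k \<and>
      I (k + 1) + S (k + 1) - I k - S k \<le> Rupp D" for k
    by (simp add: Pair ramp_terms_def less_eq_vec_def algebra_simps)
  show ?thesis
    unfolding slot ramp by (simp add: Pair deds_feasible_def)
qed

lemma violation_eq_0_iff:
  assumes "p \<in> load_set D"
  shows "violation D p = 0 \<longleftrightarrow> p \<in> deds_feasible D"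
proof
  assume "violation D p = 0"
  then show "p \<in> deds_feasible D"
    unfolding deds_feasible_iff
    using assms slot_le_violation[of _ D _ p] ramp_le_violation[of _ D _ p] by auto
next
  assume "p \<in> deds_feasible D"
  then show "violation D p = 0"
    unfolding deds_feasible_iff violation_def
    by (simp add: sum.neutral list_violation_eq_0)
qed

section \<open>Moving towards the Slater point\<close>

text \<open>
  The restriction to \<open>{1..horizon D}\<close> keeps the combination extensional, so that it is again a
  point of \<open>deds_space D\<close>.
\<close>

definition mix_blocks ::
    "('n::finite) deds \<Rightarrow> real \<Rightarrow> 'n blocks \<Rightarrow> 'n blocks \<Rightarrow> 'n blocks" where
  "mix_blocks D t x y = (\<lambda>k\<in>{1..horizon D}. (1 - t) *\<^sub>R x k + t *\<^sub>R y k)"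

definition mix ::
    "('n::finite) deds \<Rightarrow> real \<Rightarrow> 'n blocks \<times> 'n blocks \<Rightarrow> 'n blocks \<times> 'n blocks \<Rightarrow>
      'n blocks \<times> 'n blocks" where
  "mix D t p q = (mix_blocks D t (fst p) (fst q), mix_blocks D t (snd p) (snd q))"

lemma mix_blocks_apply:
  "k \<in> {1..horizon D} \<Longrightarrow> mix_blocks D t x y k = (1 - t) *\<^sub>R x k + t *\<^sub>R y k"
  by (simp add: mix_blocks_def)

lemma sum_mix_blocks:
  assumes "k \<in> {1..horizon D}"
  shows "(\<Sum>k'=1..k. mix_blocks D t x y k') =
    (1 - t) *\<^sub>R (\<Sum>k'=1..k. x k') + t *\<^sub>R (\<Sum>k'=1..k. y k')"
proof -
  have "(\<Sum>k'=1..k. mix_blocks D t x y k') = (\<Sum>k'=1..k. (1 - t) *\<^sub>R x k' + t *\<^sub>R y k')"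
    using assms by (intro sum.cong) (auto simp: mix_blocks_apply)
  then show ?thesis
    by (simp add: sum.distrib scaleR_sum_right)
qed

lemma mix_in_load_set:
  assumes "p \<in> load_set D" "q \<in> load_set D"
  shows "mix D t p q \<in> load_set D"
proof -
  have "mix D t p q \<in> deds_space D"
    by (simp add: mix_def mix_blocks_def deds_space_def)
  moreover have "1 \<bullet> fst (mix D t p q) k = load D k" if "k \<in> {1..horizon D}" for k
    using assms that
    by (auto simp: load_set_def mix_def mix_blocks_apply inner_add_right algebra_simps)
  ultimately show ?thesis
    by (auto simp: load_set_def mix_def)
qed

lemma slot_terms_mix:
  assumes "k \<in> {1..horizon D}"
  shows "slot_terms D (mix D t p q) k =
    map2 (\<lambda>A B. (1 - t) *\<^sub>R A + t *\<^sub>R B) (slot_terms D p k) (slot_terms D q k)"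
  using assms unfolding mix_def slot_terms_def case_prod_unfold fst_conv snd_conv
    sum_mix_blocks[OF assms] mix_blocks_apply[OF assms]
  by (simp add: vec_eq_iff algebra_simps)

lemma ramp_terms_mix:
  assumes "k \<in> {1..<horizon D}"
  shows "ramp_terms D (mix D t p q) k =
    map2 (\<lambda>A B. (1 - t) *\<^sub>R A + t *\<^sub>R B) (ramp_terms D p k) (ramp_terms D q k)"
proof -
  have k: "k \<in> {1..horizon D}" "k + 1 \<in> {1..horizon D}"
    using assms by auto
  show ?thesis
    unfolding mix_def ramp_terms_def case_prod_unfold fst_conv snd_conv
      mix_blocks_apply[OF k(1)] mix_blocks_apply[OF k(2)]
    by (simp add: vec_eq_iff algebra_simps)
qed

lemma map2_combination_nonpos:
  fixes As Bs :: "(real^'n::finite) list"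
  assumes "T \<in> set (map2 (\<lambda>A B. (1 - t) *\<^sub>R A + t *\<^sub>R B) As Bs)"
    and "\<And>A. A \<in> set As \<Longrightarrow> A $ i \<le> a" and "\<And>B. B \<in> set Bs \<Longrightarrow> B $ i \<le> b"
    and "0 \<le> t" "t \<le> 1" and "(1 - t) * a + t * b \<le> 0"
  shows "T $ i \<le> 0"
proof -
  obtain A B where "A \<in> set As" "B \<in> set Bs" and T: "T = (1 - t) *\<^sub>R A + t *\<^sub>R B"
    using assms(1) by (auto dest: set_zip_leftD set_zip_rightD)
  then have "(1 - t) * A $ i + t * B $ i \<le> (1 - t) * a + t * b"
    using assms by (intro add_mono mult_left_mono) auto
  then show ?thesis
    using assms(6) T by simp
qed

text \<open>
  Along the segment from \<open>p\<close> to \<open>s\<close> every constraint function is at most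
  \<open>(1 - t) v - t \<rho>\<close>, where \<open>v\<close> is the violation at \<open>p\<close>; this bound vanishes at the chosen \<open>t\<close>.
\<close>

lemma feasible_towards_slater:
  assumes "p \<in> load_set D" and "strong_slater D \<rho> s"
  shows "mix D (violation D p / (violation D p + \<rho>)) p s \<in> deds_feasible D"
proof -
  define v where "v = violation D p"
  define t where "t = v / (v + \<rho>)"
  have "0 < \<rho>" and s: "s \<in> load_set D"
    and slot: "\<And>k T i. k \<in> {1..horizon D} \<Longrightarrow> T \<in> set (slot_terms D s k) \<Longrightarrow> T $ i \<le> - \<rho>"
    and ramp: "\<And>k T i. k \<in> {1..<horizon D} \<Longrightarrow> T \<in> set (ramp_terms D s k) \<Longrightarrow> T $ i \<le> - \<rho>"
    using assms(2) unfolding strong_slater_def by (auto intro: less_imp_le)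
  have "0 \<le> v"
    by (simp add: v_def violation_nonneg)
  have t: "0 \<le> t" "t \<le> 1"
    using \<open>0 \<le> v\<close> \<open>0 < \<rho>\<close> by (auto simp: t_def)
  have balance: "(1 - t) * v + t * - \<rho> \<le> 0"
    using \<open>0 \<le> v\<close> \<open>0 < \<rho>\<close> by (simp add: t_def field_simps)
  have "T $ i \<le> 0"
    if "k \<in> {1..horizon D}" "T \<in> set (slot_terms D (mix D t p s) k)" for k T i
    using that(2) unfolding slot_terms_mix[OF that(1)]
    by (rule map2_combination_nonpos[OF _ _ _ t balance])
      (simp_all add: v_def slot_le_violation[OF that(1)] slot[OF that(1)])
  moreover have "T $ i \<le> 0"
    if "k \<in> {1..<horizon D}" "T \<in> set (ramp_terms D (mix D t p s) k)" for k T i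
    using that(2) unfolding ramp_terms_mix[OF that(1)]
    by (rule map2_combination_nonpos[OF _ _ _ t balance])
      (simp_all add: v_def ramp_le_violation[OF that(1)] ramp[OF that(1)])
  ultimately show ?thesis
    using mix_in_load_set[OF assms(1) s] by (simp add: deds_feasible_iff t_def v_def)
qed

lemma deds_objective_mix_le:
  assumes "deds_data D" and "0 \<le> t" "t \<le> 1"
  shows "deds_objective D (mix D t p q) \<le> (1 - t) * deds_objective D p + t * deds_objective D q"
proof -
  let ?x = "\<lambda>p k. fst p k + snd p k"
  have "cost D k i (?x (mix D t p q) k $ i) \<le>
      (1 - t) * cost D k i (?x p k $ i) + t * cost D k i (?x q k $ i)"
    if k: "k \<in> {1..horizon D}" for k i
  proof -
    have "convex_on UNIV (cost D k i)"
      using assms(1) k by (auto simp: deds_data_def)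
    moreover have "?x (mix D t p q) k $ i = (1 - t) *\<^sub>R (?x p k $ i) + t *\<^sub>R (?x q k $ i)"
      by (simp add: mix_def mix_blocks_apply[OF k] algebra_simps)
    ultimately show ?thesis
      using convex_onD[of UNIV "cost D k i" t] assms by simp
  qed
  then have "total_cost D (?x (mix D t p q)) \<le>
      (\<Sum>k\<in>{1..horizon D}. \<Sum>i\<in>UNIV.
        (1 - t) * cost D k i (?x p k $ i) + t * cost D k i (?x q k $ i))"
    unfolding total_cost_def by (intro sum_mono) auto
  also have "\<dots> = (1 - t) * total_cost D (?x p) + t * total_cost D (?x q)"
    by (simp add: total_cost_def sum.distrib sum_distrib_left)
  finally show ?thesis
    by (simp add: deds_objective_def case_prod_unfold)
qed

section \<open>Equality of the solution sets\<close>

(* The bound on \<epsilon> is taken in the extended reals, where \<rho> / 0 = \<infinity>: the denominator vanishes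
   when the Slater point is itself optimal, and then \<epsilon> is unrestricted. *)
theorem mainTheorem2:
  fixes D :: "('n::finite) deds"
    and I\<rho> S\<rho> Iopt Sopt :: "'n blocks"
    and \<rho> \<epsilon> :: real
  assumes "deds_data D"
    and "strong_slater D \<rho> (I\<rho>, S\<rho>)"
    and "(Iopt, Sopt) \<in> deds_solutions D"
    and "0 < \<epsilon>"
    and "ereal \<epsilon> < ereal \<rho> / ereal (total_cost D (\<lambda>k. I\<rho> k + S\<rho> k) - total_cost D (\<lambda>k. Iopt k + Sopt k))"
  shows "deds_solutions D = modified_deds_solutions D \<epsilon>"
proof -
  let ?f = "deds_objective D" and ?s = "(I\<rho>, S\<rho>)" and ?z = "(Iopt, Sopt)"
  have "0 < \<rho>"
    using assms(2) by (simp add: strong_slater_def)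
  have opt: "is_arg_min ?f (\<lambda>q. q \<in> deds_feasible D) ?z"
    using assms(3) by (simp add: deds_solutions_def)
  have "x \<le> 0" if "x < - \<rho>" for x
    using that \<open>0 < \<rho>\<close> by linarith
  then have "?s \<in> deds_feasible D"
    using assms(2) unfolding deds_feasible_iff strong_slater_def by blast
  then have gap: "0 \<le> ?f ?s - ?f ?z"
    using opt by (simp add: is_arg_min_linorder)
  have slope: "\<epsilon> * (?f ?s - ?f ?z) < \<rho>"
  proof (cases "?f ?s - ?f ?z = 0")
    case False
    with gap have "0 < ?f ?s - ?f ?z"
      by linarith
    moreover from this have "\<epsilon> < \<rho> / (?f ?s - ?f ?z)"
      using assms(5) by (simp add: deds_objective_def)
    ultimately show ?thesis
      by (simp add: pos_less_divide_eq)
  qed (simp add: \<open>0 < \<rho>\<close>)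
  have towards: "\<exists>q\<in>deds_feasible D.
      (violation D p + \<rho>) * ?f q \<le> \<rho> * ?f p + violation D p * ?f ?s"
    if "p \<in> load_set D" for p
  proof
    define v where "v = violation D p"
    define q where "q = mix D (v / (v + \<rho>)) p ?s"
    show "q \<in> deds_feasible D"
      using feasible_towards_slater[OF that assms(2)] by (simp add: q_def v_def)
    have v: "0 \<le> v" "0 < v + \<rho>"
      using violation_nonneg[of D p] \<open>0 < \<rho>\<close> by (auto simp: v_def)
    then have "?f q \<le> (1 - v / (v + \<rho>)) * ?f p + v / (v + \<rho>) * ?f ?s"
      unfolding q_def using \<open>0 < \<rho>\<close> by (intro deds_objective_mix_le assms) auto
    also have "1 - v / (v + \<rho>) = \<rho> / (v + \<rho>)"
      using v by (simp add: field_simps)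
    also have "\<rho> / (v + \<rho>) * ?f p + v / (v + \<rho>) * ?f ?s =
        (\<rho> * ?f p + v * ?f ?s) / (v + \<rho>)"
      by (simp add: add_divide_distrib)
    finally show "(violation D p + \<rho>) * ?f q \<le> \<rho> * ?f p + violation D p * ?f ?s"
      unfolding pos_le_divide_eq[OF v(2)] by (simp add: mult.commute v_def)
  qed
  have "is_arg_min ?f (\<lambda>q. q \<in> deds_feasible D) p \<longleftrightarrow>
      is_arg_min (\<lambda>q. ?f q + 1 / \<epsilon> * violation D q) (\<lambda>q. q \<in> load_set D) p" for p
    by (rule exact_penalty[where fs = "?f ?s", OF _ _ _ _ opt \<open>0 < \<rho>\<close> \<open>0 < \<epsilon>\<close> slope])
      (simp_all add: violation_nonneg violation_eq_0_iff towards subset_iff deds_feasible_iff)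
  then show ?thesis
    by (simp add: deds_solutions_def modified_deds_solutions_def
        penalized_objective_violation[abs_def])
qed

end
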